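(* For all real $a,b>0$ with $a\neq b$, writing $A=A(a,b)$, $G=G(a,b)$, $P=P(a,b)$, $X=X(a,b)$, one has $$\alpha G+(1-\alpha)A<X<\beta G+(1-\beta)A,$$ with best possible constants $\alpha=2/3$ and $\beta=(e-1)/e\approx 0.6321$, and $$A+G-\alpha_1 P<X<A+G-\beta_1 P,$$ with best possible constants $\alpha_1=1$ and $\beta_1=\pi(e-1)/(2e)\approx 0.9929$.
   Context: For real $a,b>0$ with $a\neq b$: $A(a,b)=\frac{a+b}{2}$ (arithmetic mean), $G(a,b)=\sqrt{ab}$ (geometric mean), $P(a,b)=\dfrac{a-b}{2\arcsin\left(\frac{a-b}{a+b}\right)}$ (Seiffert mean), and $X(a,b)=A\,e^{G/P-1}$. "Best possible" means that the constants $\alpha,\alpha_1$ cannot be replaced by smaller constants, and the constants $\beta,\beta_1$ cannot be replaced by larger constants, with the respective inequality still holding for all $a,b>0$, $a\neq b$. *)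

theory Defs
  imports Complex_Main
begin

definition arith_mean :: "real \<Rightarrow> real \<Rightarrow> real" where
  "arith_mean a b = (a + b) / 2"

definition geom_mean :: "real \<Rightarrow> real \<Rightarrow> real" where
  "geom_mean a b = sqrt (a * b)"

text \<open>The following two definitions are meant for positive \<open>a \<noteq> b\<close>; for \<open>a = b\<close> the
  quotient in the Seiffert mean is \<open>0 / 0 = 0\<close>.\<close>

definition seiffert_mean :: "real \<Rightarrow> real \<Rightarrow> real" where
  "seiffert_mean a b = (a - b) / (2 * arcsin ((a - b) / (a + b)))"

definition X_mean :: "real \<Rightarrow> real \<Rightarrow> real" where
  "X_mean a b = arith_mean a b * exp (geom_mean a b / seiffert_mean a b - 1)"

text \<open>Each predicate says that one of the four inequalities holds, with the given constant,
  for all admissible pairs.\<close>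

definition GA_lower :: "real \<Rightarrow> bool" where
  "GA_lower \<alpha> \<longleftrightarrow> (\<forall>a b. a > 0 \<longrightarrow> b > 0 \<longrightarrow> a \<noteq> b \<longrightarrow>
     \<alpha> * geom_mean a b + (1 - \<alpha>) * arith_mean a b < X_mean a b)"

definition GA_upper :: "real \<Rightarrow> bool" where
  "GA_upper \<beta> \<longleftrightarrow> (\<forall>a b. a > 0 \<longrightarrow> b > 0 \<longrightarrow> a \<noteq> b \<longrightarrow>
     X_mean a b < \<beta> * geom_mean a b + (1 - \<beta>) * arith_mean a b)"

definition AGP_lower :: "real \<Rightarrow> bool" where
  "AGP_lower \<alpha> \<longleftrightarrow> (\<forall>a b. a > 0 \<longrightarrow> b > 0 \<longrightarrow> a \<noteq> b \<longrightarrow>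
     arith_mean a b + geom_mean a b - \<alpha> * seiffert_mean a b < X_mean a b)"

definition AGP_upper :: "real \<Rightarrow> bool" where
  "AGP_upper \<beta> \<longleftrightarrow> (\<forall>a b. a > 0 \<longrightarrow> b > 0 \<longrightarrow> a \<noteq> b \<longrightarrow>
     X_mean a b < arith_mean a b + geom_mean a b - \<beta> * seiffert_mean a b)"

end

(* Scaling to A = 1 and putting |a - b| / (a + b) = sin t with 0 < t < pi/2, the means become
   G = cos t, P = u := sin t / t and X = exp (cos t / u - 1). Taking logarithms, each of the
   inequalities compares log X with the logarithm of a trigonometric expression, and the
   difference f of the two sides is studied through the sign of its derivative.

   For G and A the derivative of f has the sign of a function k with k(0) = 0 and
   k' = s^2 (1 - 2 r^2 - r cos t) / (cos t + r)^2, where s = sin t and the right-hand side of the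
   inequality is (cos t + r) / (1 + r). The last factor is increasing and is positive for
   r = 1/2, so the lower bound follows. For r = 1 / (e - 1), where f vanishes at both endpoints,
   f first decreases and then increases, hence it is negative in between.

   For A + G - b P the derivative has the sign of b R - 1, where R = (u^2 + u) / (1 + cos t) starts
   at 1 and increases; up to the substitution h = t/2 this is the Wilker quotient
   ((sin h / h)^2 + tan h / h) / 2, and its monotonicity reduces to Cusa's inequality
   3 sin z < z (2 + cos z). Again b = 1 gives a monotone f and the other constant an f that
   decreases and then increases, vanishing at pi/2.

   The optimality of the constants is read off from the limits at 0 and at pi/2. *)

theory Submission
  imports Defs "HOL-Real_Asymp.Real_Asymp"
begin

section \<open>The quotient of sin t by t\<close>

text \<open>The value 1 at 0 is the continuous extension. It lets the functions built from
  \<open>sinc\<close> be continuous on the closed interval from 0 to pi/2 and be evaluated at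
  0.\<close>

definition sinc :: "real \<Rightarrow> real" where
  "sinc t = (if t = 0 then 1 else sin t / t)"

lemma sinc_0 [simp]: "sinc 0 = 1"
  by (simp add: sinc_def)

lemma sin_eq_sinc: "sin t = t * sinc t"
  by (simp add: sinc_def)

lemma sinc_has_real_derivative:
  assumes "t \<noteq> 0"
  shows "(sinc has_real_derivative (cos t - sinc t) / t) (at t)"
proof -
  have "((\<lambda>x. sin x / x) has_real_derivative (cos t - sinc t) / t) (at t)"
    using assms by (auto intro!: derivative_eq_intros simp: sinc_def field_simps)
  then show ?thesis
    by (rule has_field_derivative_transform_within_open[where S = "- {0}"])
      (use assms in \<open>auto simp: sinc_def\<close>)
qed

lemma isCont_sinc: "isCont sinc t"
proof (cases "t = 0")
  case True
  have "((\<lambda>h::real. sin h / h) \<longlongrightarrow> 1) (at 0)"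
    by real_asymp
  then have "(sinc \<longlongrightarrow> 1) (at 0)"
    by (rule Lim_transform_within_open[where s = UNIV]) (auto simp: sinc_def)
  with True show ?thesis
    by (simp add: isCont_def)
qed (auto intro: DERIV_isCont sinc_has_real_derivative)

lemma continuous_on_sinc [continuous_intros]:
  "continuous_on S f \<Longrightarrow> continuous_on S (\<lambda>x. sinc (f x))"
  by (rule continuous_on_compose2[of UNIV sinc])
    (auto intro: continuous_at_imp_continuous_on isCont_sinc)

lemma sinc_pos: "0 \<le> t \<Longrightarrow> t < pi \<Longrightarrow> 0 < sinc t"
  by (auto simp: sinc_def sin_gt_zero)

text \<open>Pythagoras in terms of \<open>sinc\<close>. It removes \<open>t\<^sup>2\<close> from the
  numerators of derivatives, leaving polynomials in \<open>sinc t\<close> and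
  \<open>cos t\<close>.\<close>

lemma sinc_identity: "t\<^sup>2 * (sinc t)\<^sup>2 = 1 - (cos t)\<^sup>2"
  using sin_squared_eq[of t] by (simp add: sin_eq_sinc power_mult_distrib)

section \<open>Monotonicity from the sign of the derivative\<close>

lemma strict_increasing_via_deriv:
  fixes f :: "real \<Rightarrow> real"
  assumes "a < b" and "continuous_on {a..b} f"
    and "\<And>x. a < x \<Longrightarrow> x < b \<Longrightarrow> (f has_real_derivative f' x) (at x)"
    and "\<And>x. a < x \<Longrightarrow> x < b \<Longrightarrow> 0 < f' x"
  shows "f a < f b"
  using assms by (intro DERIV_pos_imp_increasing_open[of a b f]) auto

lemma sinc_less_1:
  assumes "0 < t" "t < pi"
  shows "sinc t < 1"
proof -
  have "0 - sin 0 < t - sin t"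
  proof (rule strict_increasing_via_deriv[where f = "\<lambda>x. x - sin x" and f' = "\<lambda>x. 1 - cos x"])
    show "0 < 1 - cos x" if "0 < x" "x < t" for x
      using that assms cos_monotone_0_pi[of 0 x] by simp
  qed (use assms in \<open>auto intro!: continuous_intros derivative_eq_intros\<close>)
  with assms show ?thesis by (simp add: sinc_def)
qed

text \<open>The derivative has the sign of \<open>K\<close>, and \<open>K\<close> stays positive
  once it is nonnegative. If \<open>K x\<close> is nonnegative, \<open>f\<close> increases strictly
  from x to b. Otherwise \<open>K\<close> is negative on all of (a, x), since a nonnegative value
  there would make \<open>K x\<close> positive, so \<open>f\<close> decreases strictly from a to
  x.\<close>

lemma less_max_endpoints:
  fixes f :: "real \<Rightarrow> real"
  assumes cont: "continuous_on {a..b} f"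
    and deriv: "\<And>x. a < x \<Longrightarrow> x < b \<Longrightarrow> (f has_real_derivative p x * K x) (at x)"
    and p: "\<And>x. a < x \<Longrightarrow> x < b \<Longrightarrow> 0 < p x"
    and K: "\<And>x y. a < x \<Longrightarrow> x < y \<Longrightarrow> y < b \<Longrightarrow> 0 \<le> K x \<Longrightarrow> 0 < K y"
    and x: "a < x" "x < b"
  shows "f x < max (f a) (f b)"
proof (cases "0 \<le> K x")
  case True
  have "f x < f b"
  proof (rule strict_increasing_via_deriv[where f = f
        and f' = "\<lambda>y. p y * K y"])
    show "continuous_on {x..b} f"
      using cont x by (auto intro: continuous_on_subset)
    show "0 < p y * K y" if "x < y" "y < b" for y
      using K[OF _ that True] p[of y] x that by simp
  qed (use x deriv in auto)
  then show ?thesis by simp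
next
  case False
  have "- f a < - f x"
  proof (rule strict_increasing_via_deriv[where f = "\<lambda>y. - f y"
        and f' = "\<lambda>y. - (p y * K y)"])
    show "continuous_on {a..x} (\<lambda>y. - f y)"
      using cont x by (auto intro!: continuous_intros intro: continuous_on_subset)
    show "((\<lambda>y. - f y) has_real_derivative - (p y * K y)) (at y)" if "a < y" "y < x" for y
      using that x by (intro DERIV_minus deriv) auto
    show "0 < - (p y * K y)" if "a < y" "y < x" for y
      using K[OF that(1,2) x(2)] p[of y] x that False by (force simp: mult_pos_neg)
  qed (use x in auto)
  then show ?thesis by simp
qed

section \<open>The logarithm of X, normalised to A = 1\<close>

definition log_X :: "real \<Rightarrow> real" where
  "log_X t = cos t / sinc t - 1"

lemma log_X_0 [simp]: "log_X 0 = 0" and log_X_pi_half [simp]: "log_X (pi / 2) = -1"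
  by (simp_all add: log_X_def)

lemma continuous_on_log_X: "continuous_on {0..pi / 2} log_X"
proof -
  have "sinc t > 0" if "t \<in> {0..pi / 2}" for t
    using that pi_gt_zero unfolding atLeastAtMost_iff by (intro sinc_pos; linarith)
  then show ?thesis
    unfolding log_X_def by (intro continuous_intros) force+
qed

text \<open>With u = \<open>sinc t\<close> and c = \<open>cos t\<close>, the numerator of the
  quotient rule times t is -t^2 u^2 - c^2 + u c, which \<open>sinc_identity\<close> collapses to u c
  - 1.\<close>

lemma log_X_has_real_derivative:
  assumes "0 < t" "t < pi"
  shows "(log_X has_real_derivative (sinc t * cos t - 1) / (t * (sinc t)\<^sup>2)) (at t)"
proof -
  have u: "sinc t > 0"
    using assms by (simp add: sinc_pos)
  have eq: "(- sin t * sinc t - cos t * ((cos t - sinc t) / t)) / (sinc t * sinc t)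
      = (sinc t * cos t - 1) / (t * (sinc t)\<^sup>2)"
    using assms u sinc_identity[of t]
    by (simp add: sin_eq_sinc field_simps power2_eq_square)
  show ?thesis
    unfolding log_X_def
    by (rule derivative_eq_intros sinc_has_real_derivative refl | use assms u eq in force)+
qed

section \<open>Comparison of X with G and A\<close>

text \<open>The parameter r encodes the weight 1 / (1 + r) of G: r = 1/2 gives 2/3, and r = 1 / (e -
  1) gives (e - 1) / e.\<close>

definition GA_gap :: "real \<Rightarrow> real \<Rightarrow> real" where
  "GA_gap r t = log_X t - ln ((cos t + r) / (1 + r))"

text \<open>The derivative of \<open>GA_gap r\<close> multiplied by \<open>(sin t)\<^sup>2\<close>.
  Outside the trigonometric functions t now occurs only as the summand -t, so one more
  differentiation removes it.\<close>

definition GA_sign :: "real \<Rightarrow> real \<Rightarrow> real" where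
  "GA_sign r t = sin t * cos t - t + sin t ^ 3 / (cos t + r)"

context
  fixes r :: real
  assumes r: "0 < r"
begin

lemma cos_add_pos: "0 \<le> t \<Longrightarrow> t \<le> pi / 2 \<Longrightarrow> 0 < cos t + r"
  using cos_ge_zero[of t] r pi_gt_zero by auto

lemma GA_gap_0 [simp]: "GA_gap r 0 = 0"
  using r by (simp add: GA_gap_def)

lemma continuous_on_GA_gap: "continuous_on {0..pi / 2} (GA_gap r)"
proof -
  have "(cos t + r) / (1 + r) > 0" if "t \<in> {0..pi / 2}" for t
    using cos_add_pos[of t] that r by simp
  then show ?thesis
    using r unfolding GA_gap_def by (intro continuous_intros continuous_on_log_X) force+
qed

lemma GA_gap_has_real_derivative:
  assumes "0 < t" "t < pi / 2"
  shows "(GA_gap r has_real_derivative 1 / (sin t)\<^sup>2 * GA_sign r t) (at t)"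
proof -
  have u: "sinc t > 0" and c: "cos t + r > 0"
    using assms cos_add_pos by (auto simp: sinc_pos)
  have eq: "(sinc t * cos t - 1) / (t * (sinc t)\<^sup>2) + sin t / (cos t + r)
      = 1 / (sin t)\<^sup>2 * GA_sign r t"
    using assms u c unfolding GA_sign_def sin_eq_sinc
    by (simp add: divide_simps) (simp add: algebra_simps power2_eq_square power3_eq_cube)
  have "((\<lambda>t. ln ((cos t + r) / (1 + r))) has_real_derivative
      1 / ((cos t + r) / (1 + r)) * (- sin t / (1 + r))) (at t)"
    using c r by (intro DERIV_chain2[OF DERIV_ln_divide]) (auto intro!: derivative_eq_intros)
  then have "((\<lambda>t. ln ((cos t + r) / (1 + r))) has_real_derivative - sin t / (cos t + r)) (at t)"
    using r by simp
  from DERIV_diff[OF log_X_has_real_derivative this] assms eq show ?thesis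
    unfolding GA_gap_def by simp
qed

lemma continuous_on_GA_sign: "continuous_on {0..pi / 2} (GA_sign r)"
  unfolding GA_sign_def using cos_add_pos by (intro continuous_intros) force+

text \<open>Both cos^2 - sin^2 - 1 = -2 sin^2 and sin^4 = sin^2 (1 - cos^2) contain the factor
  sin^2. Once it is taken out, the squares of the cosine cancel over the common denominator, and a
  factor linear in \<open>cos t\<close> remains.\<close>

lemma GA_sign_has_real_derivative:
  assumes "0 < t" "t < pi / 2"
  shows "(GA_sign r has_real_derivative
    (sin t)\<^sup>2 / (cos t + r)\<^sup>2 * (1 - 2 * r\<^sup>2 - cos t * r)) (at t)"
proof -
  have c: "cos t + r > 0"
    using assms cos_add_pos by auto
  have s4: "sin t ^ 4 = (sin t)\<^sup>2 * (1 - (cos t)\<^sup>2)"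
    using sin_squared_eq[of t] by (simp add: power4_eq_xxxx power2_eq_square)
  have "cos t * cos t - sin t * sin t - 1
      + (3 * (sin t)\<^sup>2 * cos t * (cos t + r) + sin t ^ 4) / (cos t + r)\<^sup>2
      = (sin t)\<^sup>2 * (- 2 + (3 * cos t * (cos t + r) + 1 - (cos t)\<^sup>2) / (cos t + r)\<^sup>2)"
    unfolding s4 using cos_squared_eq[of t]
    by (simp add: power2_eq_square algebra_simps add_divide_distrib diff_divide_distrib)
  also have "\<dots> = (sin t)\<^sup>2 * ((1 - 2 * r\<^sup>2 - cos t * r) / (cos t + r)\<^sup>2)"
    using c by (simp add: divide_simps) (simp add: algebra_simps power2_eq_square)
  finally have eq: "cos t * cos t - sin t * sin t - 1
      + (3 * (sin t)\<^sup>2 * cos t * (cos t + r) + sin t ^ 4) / (cos t + r)\<^sup>2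
      = (sin t)\<^sup>2 / (cos t + r)\<^sup>2 * (1 - 2 * r\<^sup>2 - cos t * r)"
    by simp
  have "(GA_sign r has_real_derivative cos t * cos t - sin t * sin t - 1
      + (3 * (sin t)\<^sup>2 * cos t * (cos t + r) + sin t ^ 4) / (cos t + r)\<^sup>2) (at t)"
    unfolding GA_sign_def using c
    by (auto intro!: derivative_eq_intros
        simp: power2_eq_square power4_eq_xxxx power3_eq_cube algebra_simps)
  with eq show ?thesis by simp
qed

end

text \<open>The value r = 1/2 is the positive root of 1 - 2 r^2 - r, so the linear factor vanishes
  at 0 and equals (1 - cos y) / 2. Hence \<open>GA_sign (1 / 2)\<close> and then
  \<open>GA_gap (1 / 2)\<close> increase from their value 0 at 0.\<close>

lemma GA_lower_trig:
  assumes "0 < t" "t < pi / 2"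
  shows "2 / 3 * cos t + 1 / 3 < exp (log_X t)"
proof -
  have sign: "0 < GA_sign (1 / 2) x" if x: "0 < x" "x < pi / 2" for x
  proof -
    have "GA_sign (1 / 2) 0 < GA_sign (1 / 2) x"
    proof (rule strict_increasing_via_deriv[where f = "GA_sign (1 / 2)"
          and f' = "\<lambda>y. (sin y)\<^sup>2 / (cos y + 1 / 2)\<^sup>2 * (1 - 2 * (1 / 2)\<^sup>2 - cos y * (1 / 2))"])
      show "continuous_on {0..x} (GA_sign (1 / 2))"
        using x by (auto intro: continuous_on_subset[OF continuous_on_GA_sign])
      fix y assume y: "0 < y" "y < x"
      show "(GA_sign (1 / 2) has_real_derivative
          (sin y)\<^sup>2 / (cos y + 1 / 2)\<^sup>2 * (1 - 2 * (1 / 2)\<^sup>2 - cos y * (1 / 2))) (at y)"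
        using x y by (intro GA_sign_has_real_derivative) auto
      have "cos y < 1" "cos y > 0" "sin y > 0"
        using x y cos_monotone_0_pi[of 0 y] cos_gt_zero[of y] sin_gt_zero[of y] by auto
      then show "0 < (sin y)\<^sup>2 / (cos y + 1 / 2)\<^sup>2 * (1 - 2 * (1 / 2)\<^sup>2 - cos y * (1 / 2))"
        by (intro mult_pos_pos divide_pos_pos) (auto simp: power2_eq_square)
    qed (use x in auto)
    then show ?thesis by (simp add: GA_sign_def)
  qed
  have "GA_gap (1 / 2) 0 < GA_gap (1 / 2) t"
  proof (rule strict_increasing_via_deriv[where f = "GA_gap (1 / 2)"
        and f' = "\<lambda>x. 1 / (sin x)\<^sup>2 * GA_sign (1 / 2) x"])
    show "continuous_on {0..t} (GA_gap (1 / 2))"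
      using assms by (auto intro: continuous_on_subset[OF continuous_on_GA_gap])
    fix x assume x: "0 < x" "x < t"
    show "(GA_gap (1 / 2) has_real_derivative 1 / (sin x)\<^sup>2 * GA_sign (1 / 2) x) (at x)"
      using x assms by (intro GA_gap_has_real_derivative) auto
    show "0 < 1 / (sin x)\<^sup>2 * GA_sign (1 / 2) x"
      using x assms sign[of x] sin_gt_zero[of x] by (simp add: zero_less_mult_iff)
  qed (use assms in auto)
  then have "ln ((cos t + 1 / 2) / (1 + 1 / 2)) < log_X t"
    by (simp add: GA_gap_def)
  moreover have "cos t > 0"
    using assms by (simp add: cos_gt_zero)
  ultimately have "(cos t + 1 / 2) / (1 + 1 / 2) < exp (log_X t)"
    by (subst ln_less_cancel_iff[symmetric]) auto
  then show ?thesis by (simp add: field_simps)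
qed

lemma GA_upper_trig:
  assumes t: "0 < t" "t < pi / 2"
  defines "\<beta> \<equiv> (exp 1 - 1) / exp 1 :: real"
  shows "exp (log_X t) < \<beta> * cos t + (1 - \<beta>)"
proof -
  define r :: real where "r = 1 / (exp 1 - 1)"
  have e: "exp (1::real) > 1" by simp
  then have r: "r > 0" by (simp add: r_def)
  define w where "w x = 1 - 2 * r\<^sup>2 - cos x * r" for x
  have w_mono: "w x < w y" if "0 < x" "x < y" "y < pi / 2" for x y
    using cos_monotone_0_pi[of x y] that r by (simp add: w_def)
  \<comment> \<open>\<open>GA_sign r\<close> starts at 0 and its derivative has the sign of the
    increasing function \<open>w\<close>. If \<open>w x\<close> were not positive, \<open>w\<close>
    would be negative before x and \<open>GA_sign r x\<close> would be negative. So \<open>w\<close>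
    is positive from x on, and \<open>GA_sign r\<close> increases there.\<close>
  have K: "0 < GA_sign r y" if xy: "0 < x" "x < y" "y < pi / 2" and nonneg: "0 \<le> GA_sign r x" for x y
  proof -
    have wx: "0 < w x"
    proof (rule ccontr)
      assume "\<not> 0 < w x"
      then have "w z < 0" if "0 < z" "z < x" for z
        using w_mono[of z x] that xy by auto
      have "- GA_sign r 0 < - GA_sign r x"
      proof (rule strict_increasing_via_deriv[where f = "\<lambda>z. - GA_sign r z"
            and f' = "\<lambda>z. - ((sin z)\<^sup>2 / (cos z + r)\<^sup>2 * w z)"])
        show "continuous_on {0..x} (\<lambda>z. - GA_sign r z)"
          using xy by (auto intro!: continuous_intros
              intro: continuous_on_subset[OF continuous_on_GA_sign[OF r]])
        fix z assume z: "0 < z" "z < x"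
        show "((\<lambda>z. - GA_sign r z) has_real_derivative
            - ((sin z)\<^sup>2 / (cos z + r)\<^sup>2 * w z)) (at z)"
          unfolding w_def using z xy by (intro DERIV_minus GA_sign_has_real_derivative r) auto
        have "sin z > 0" "cos z + r > 0" "w z < 0"
          using z xy sin_gt_zero[of z] cos_add_pos[OF r, of z] \<open>\<And>z. _ \<Longrightarrow> _ \<Longrightarrow> w z < 0\<close> by auto
        then show "0 < - ((sin z)\<^sup>2 / (cos z + r)\<^sup>2 * w z)"
          by (simp add: mult_pos_neg divide_neg_pos)
      qed (use xy in auto)
      with nonneg show False by (simp add: GA_sign_def)
    qed
    have "GA_sign r x < GA_sign r y"
    proof (rule strict_increasing_via_deriv[where f = "GA_sign r"
          and f' = "\<lambda>z. (sin z)\<^sup>2 / (cos z + r)\<^sup>2 * w z"])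
      show "continuous_on {x..y} (GA_sign r)"
        using xy by (auto intro: continuous_on_subset[OF continuous_on_GA_sign[OF r]])
      fix z assume z: "x < z" "z < y"
      show "(GA_sign r has_real_derivative (sin z)\<^sup>2 / (cos z + r)\<^sup>2 * w z) (at z)"
        unfolding w_def using z xy by (intro GA_sign_has_real_derivative r) auto
      have "sin z > 0" "cos z + r > 0" "w z > 0"
        using z xy sin_gt_zero[of z] cos_add_pos[OF r, of z] w_mono[of x z] wx by auto
      then show "0 < (sin z)\<^sup>2 / (cos z + r)\<^sup>2 * w z"
        by simp
    qed (use xy in auto)
    with nonneg show ?thesis by simp
  qed
  have beta: "(x + r) / (1 + r) = \<beta> * x + (1 - \<beta>)" for x
    using e by (simp add: r_def \<beta>_def field_simps)
  have "1 - \<beta> = exp (-1)"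
    using e by (simp add: \<beta>_def exp_minus field_simps)
  \<comment> \<open>This equation is what determines r: at pi/2 the fraction is r / (1 + r) = exp
    (-1), while \<open>log_X\<close> is -1.\<close>
  then have end_val: "GA_gap r (pi / 2) = 0"
    using beta[of 0] by (simp add: GA_gap_def)
  have "GA_gap r t < max (GA_gap r 0) (GA_gap r (pi / 2))"
  proof (rule less_max_endpoints[where f = "GA_gap r" and K = "GA_sign r"
        and p = "\<lambda>x. 1 / (sin x)\<^sup>2"])
    show "continuous_on {0..pi / 2} (GA_gap r)"
      by (rule continuous_on_GA_gap[OF r])
    show "(GA_gap r has_real_derivative 1 / (sin x)\<^sup>2 * GA_sign r x) (at x)"
      if "0 < x" "x < pi / 2" for x
      using that by (rule GA_gap_has_real_derivative[OF r])
    show "0 < 1 / (sin x)\<^sup>2" if "0 < x" "x < pi / 2" for x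
      using that sin_gt_zero[of x] by simp
  qed (use t K in auto)
  then have "log_X t < ln ((cos t + r) / (1 + r))"
    using end_val GA_gap_0[OF r] by (simp add: GA_gap_def)
  moreover have "(cos t + r) / (1 + r) > 0"
    using cos_add_pos[OF r, of t] t r by simp
  ultimately show ?thesis
    by (metis beta exp_less_cancel_iff exp_ln)
qed

section \<open>Cusa's inequality and the Wilker quotient\<close>

text \<open>Cusa's inequality, by three integrations from 0: the difference of the two sides has
  derivative 2 - 2 cos y - y sin y, this has derivative sin y - y cos y, and this in turn has
  derivative y sin y > 0. All three functions vanish at 0.\<close>

lemma sin_times_3_less:
  fixes t :: real
  assumes "0 < t" "t < pi"
  shows "3 * sin t < t * (2 + cos t)"
proof -
  have tan: "0 < sin x - x * cos x" if x: "0 < x" "x < pi" for x :: real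
  proof -
    have "sin 0 - 0 * cos 0 < sin x - x * cos x"
    proof (rule strict_increasing_via_deriv[where f = "\<lambda>x. sin x - x * cos x"
          and f' = "\<lambda>y. y * sin y"])
      show "0 < y * sin y" if "0 < y" "y < x" for y
        using that x sin_gt_zero[of y] by simp
    qed (use x in \<open>auto intro!: continuous_intros derivative_eq_intros\<close>)
    then show ?thesis by simp
  qed
  have second: "0 < 2 - 2 * cos x - x * sin x" if x: "0 < x" "x < pi" for x :: real
  proof -
    have "2 - 2 * cos 0 - 0 * sin 0 < 2 - 2 * cos x - x * sin x"
    proof (rule strict_increasing_via_deriv[where f = "\<lambda>x. 2 - 2 * cos x - x * sin x"
          and f' = "\<lambda>y. sin y - y * cos y"])
      show "0 < sin y - y * cos y" if "0 < y" "y < x" for y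
        using that x tan[of y] by simp
    qed (use x in \<open>auto intro!: continuous_intros derivative_eq_intros\<close>)
    then show ?thesis by simp
  qed
  have "0 * (2 + cos 0) - 3 * sin 0 < t * (2 + cos t) - 3 * sin t"
  proof (rule strict_increasing_via_deriv[where f = "\<lambda>t. t * (2 + cos t) - 3 * sin t"
        and f' = "\<lambda>y. 2 - 2 * cos y - y * sin y"])
    show "0 < 2 - 2 * cos y - y * sin y" if "0 < y" "y < t" for y
      using that assms second[of y] by simp
  qed (use assms in \<open>auto intro!: continuous_intros derivative_eq_intros\<close>)
  then show ?thesis by simp
qed

text \<open>Multiplied by 4 t^2 and rewritten with the double angle z = 2t, the expression becomes
  \<open>h z\<close>. Here \<open>h\<close> vanishes at 0 and its derivative is the difference in
  Cusa's inequality, which applies because z < pi.\<close>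

lemma sinc_quadratic_pos:
  assumes "0 < t" "t < pi / 2"
  shows "0 < 1 + sinc t * cos t - 2 * (sinc t)\<^sup>2"
proof -
  define h :: "real \<Rightarrow> real" where "h z = z\<^sup>2 + z * sin z - 4 + 4 * cos z" for z
  have "h 0 < h (2 * t)"
  proof (rule strict_increasing_via_deriv[where f = h
        and f' = "\<lambda>z. z * (2 + cos z) - 3 * sin z"])
    show "continuous_on {0..2 * t} h"
      unfolding h_def by (intro continuous_intros)
    show "(h has_real_derivative z * (2 + cos z) - 3 * sin z) (at z)" for z
      unfolding h_def by (auto intro!: derivative_eq_intros simp: algebra_simps)
    show "0 < z * (2 + cos z) - 3 * sin z" if "0 < z" "z < 2 * t" for z
      using sin_times_3_less[of z] that assms by simp
  qed (use assms in auto)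
  also have "h (2 * t) = 4 * t\<^sup>2 * (1 + sinc t * cos t - 2 * (sinc t)\<^sup>2)"
    unfolding h_def cos_double_sin sin_double unfolding sin_eq_sinc
    by (simp add: algebra_simps power2_eq_square)
  finally have "0 < 4 * t\<^sup>2 * (1 + sinc t * cos t - 2 * (sinc t)\<^sup>2)"
    by (simp add: h_def)
  then show ?thesis
    using assms by (simp add: zero_less_mult_iff)
qed

definition wilker :: "real \<Rightarrow> real" where
  "wilker t = ((sinc t)\<^sup>2 + sinc t) / (1 + cos t)"

lemma wilker_strict_mono:
  assumes "0 \<le> x" "x < y" "y < pi / 2"
  shows "wilker x < wilker y"
proof (rule strict_increasing_via_deriv[where f = wilker
      and f' = "\<lambda>t. (1 + sinc t * cos t - 2 * (sinc t)\<^sup>2) / (t * (1 + cos t))"])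
  have cos: "cos t > 0" if "0 \<le> t" "t < pi / 2" for t
    using that by (intro cos_gt_zero_pi) auto
  show "continuous_on {x..y} wilker"
    unfolding wilker_def using cos assms
    by (intro continuous_intros) (auto dest!: spec intro!: add_pos_pos less_imp_neq[symmetric])
  fix t assume t: "x < t" "t < y"
  have c: "cos t > 0"
    using cos[of t] t assms by simp
  have t0: "t > 0" using t assms by simp
  have "((2 * sinc t + 1) * ((cos t - sinc t) / t) * (1 + cos t)
      + ((sinc t)\<^sup>2 + sinc t) * sin t) / (1 + cos t)\<^sup>2
      = ((2 * sinc t + 1) * (cos t - sinc t) * (1 + cos t)
      + (sinc t + 1) * (t\<^sup>2 * (sinc t)\<^sup>2)) / (t * (1 + cos t)\<^sup>2)"
    using t0 c by (simp add: sin_eq_sinc divide_simps) (simp add: algebra_simps power2_eq_square)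
  also have "\<dots> = (1 + sinc t * cos t - 2 * (sinc t)\<^sup>2) * (1 + cos t) / (t * (1 + cos t)\<^sup>2)"
    unfolding sinc_identity by (simp add: algebra_simps power2_eq_square)
  also have "\<dots> = (1 + sinc t * cos t - 2 * (sinc t)\<^sup>2) / (t * (1 + cos t))"
    using c by (simp add: power2_eq_square)
  finally have eq: "((2 * sinc t + 1) * ((cos t - sinc t) / t) * (1 + cos t)
      + ((sinc t)\<^sup>2 + sinc t) * sin t) / (1 + cos t)\<^sup>2
      = (1 + sinc t * cos t - 2 * (sinc t)\<^sup>2) / (t * (1 + cos t))" .
  have "(wilker has_real_derivative ((2 * sinc t + 1) * ((cos t - sinc t) / t) * (1 + cos t)
      + ((sinc t)\<^sup>2 + sinc t) * sin t) / (1 + cos t)\<^sup>2) (at t)"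
    unfolding wilker_def using c t0
    by (auto intro!: derivative_eq_intros sinc_has_real_derivative
        simp: power2_eq_square algebra_simps add_divide_distrib)
  then show "(wilker has_real_derivative
      (1 + sinc t * cos t - 2 * (sinc t)\<^sup>2) / (t * (1 + cos t))) (at t)"
    unfolding eq .
  show "0 < (1 + sinc t * cos t - 2 * (sinc t)\<^sup>2) / (t * (1 + cos t))"
    using sinc_quadratic_pos[of t] t t0 c assms by simp
qed (use assms in auto)

lemma wilker_gt_1: "0 < t \<Longrightarrow> t < pi / 2 \<Longrightarrow> 1 < wilker t"
  using wilker_strict_mono[of 0 t] by (simp add: wilker_def)

section \<open>Comparison of X with A + G - b P\<close>

definition AGP_gap :: "real \<Rightarrow> real \<Rightarrow> real" where
  "AGP_gap b t = log_X t - ln (1 + cos t - b * sinc t)"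

context
  fixes b :: real
  assumes b: "0 < b" "b \<le> 1"
begin

lemma AGP_arg_pos:
  assumes "0 \<le> t" "t \<le> pi / 2"
  shows "0 < 1 + cos t - b * sinc t"
proof (cases "t = 0")
  case False
  then have "sinc t < 1" "sinc t > 0" "cos t \<ge> 0"
    using assms sinc_less_1[of t] sinc_pos[of t] cos_ge_zero[of t] pi_gt_zero by auto
  with b have "b * sinc t < 1"
    by (smt (verit) mult_left_le_one_le)
  with \<open>cos t \<ge> 0\<close> show ?thesis by simp
qed (use b in simp)

lemma continuous_on_AGP_gap: "continuous_on {0..pi / 2} (AGP_gap b)"
  unfolding AGP_gap_def using AGP_arg_pos
  by (intro continuous_intros continuous_on_log_X) force+

lemma AGP_gap_weight_pos:
  assumes "0 < t" "t < pi / 2"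
  shows "0 < (1 - sinc t) * (1 + cos t) / (t * (sinc t)\<^sup>2 * (1 + cos t - b * sinc t))"
  using assms sinc_less_1[of t] sinc_pos[of t] cos_gt_zero[of t] AGP_arg_pos[of t]
  by (intro divide_pos_pos mult_pos_pos) auto

text \<open>Over the common denominator, \<open>sinc_identity\<close> makes the terms of higher
  degree in \<open>cos t\<close> cancel, and the numerator factors as (1 - u) (b (u^2 + u) - (1 +
  c)). Taking out the positive factor 1 + c leaves \<open>b * wilker t - 1\<close>, which carries
  the sign.\<close>

lemma AGP_gap_has_real_derivative:
  assumes "0 < t" "t < pi / 2"
  shows "(AGP_gap b has_real_derivative
    (1 - sinc t) * (1 + cos t) / (t * (sinc t)\<^sup>2 * (1 + cos t - b * sinc t))
      * (b * wilker t - 1)) (at t)"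
proof -
  define u c where "u = sinc t" and "c = cos t"
  have u: "u > 0" and c: "c > 0" and d: "1 + c - b * u > 0"
    using assms sinc_pos[of t] cos_gt_zero[of t] AGP_arg_pos[of t] by (auto simp: u_def c_def)
  have tu: "t\<^sup>2 * u\<^sup>2 = 1 - c\<^sup>2"
    unfolding u_def c_def by (rule sinc_identity)
  have "(u * c - 1) / (t * u\<^sup>2) + (t * u + b * ((c - u) / t)) / (1 + c - b * u)
      = ((u * c - 1) * (1 + c - b * u) + u * (t\<^sup>2 * u\<^sup>2) + b * u\<^sup>2 * (c - u))
        / (t * u\<^sup>2 * (1 + c - b * u))"
    using assms u d by (simp add: divide_simps) (simp add: algebra_simps power2_eq_square)
  also have "(u * c - 1) * (1 + c - b * u) + u * (t\<^sup>2 * u\<^sup>2) + b * u\<^sup>2 * (c - u)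
      = (1 - u) * (b * (u\<^sup>2 + u) - (1 + c))"
    unfolding tu by (simp add: algebra_simps power2_eq_square)
  also have "\<dots> = (1 - u) * (1 + c) * (b * ((u\<^sup>2 + u) / (1 + c)) - 1)"
    using c by (simp add: right_diff_distrib)
  finally have eq: "(u * c - 1) / (t * u\<^sup>2) + (t * u + b * ((c - u) / t)) / (1 + c - b * u)
      = (1 - u) * (1 + c) / (t * u\<^sup>2 * (1 + c - b * u)) * (b * ((u\<^sup>2 + u) / (1 + c)) - 1)"
    by simp
  have "((\<lambda>t. 1 + cos t - b * sinc t) has_real_derivative
      - sin t - b * ((cos t - sinc t) / t)) (at t)"
    using assms by (auto intro!: derivative_eq_intros sinc_has_real_derivative)
  then have "((\<lambda>t. 1 + cos t - b * sinc t) has_real_derivative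
      - (t * u + b * ((c - u) / t))) (at t)"
    by (simp only: sin_eq_sinc u_def c_def minus_add_distrib diff_conv_add_uminus)
  from DERIV_chain2[OF DERIV_ln_divide this] d
  have "((\<lambda>t. ln (1 + cos t - b * sinc t)) has_real_derivative
      1 / (1 + c - b * u) * - (t * u + b * ((c - u) / t))) (at t)"
    unfolding u_def c_def by simp
  then have "((\<lambda>t. ln (1 + cos t - b * sinc t)) has_real_derivative
      - ((t * u + b * ((c - u) / t)) / (1 + c - b * u))) (at t)"
    by (simp only: mult_minus_right times_divide_eq_left mult_1)
  from DERIV_diff[OF log_X_has_real_derivative this] assms eq show ?thesis
    unfolding AGP_gap_def wilker_def u_def c_def by simp
qed

end

text \<open>For b = 1 the gap is 0 at 0 and increases because \<open>wilker\<close> exceeds 1. The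
  endpoint pi/2 is included because the bound there is needed to place the upper constant below
  1.\<close>

lemma AGP_gap_1_pos:
  assumes "0 < t" "t \<le> pi / 2"
  shows "0 < AGP_gap 1 t"
proof -
  have "AGP_gap 1 0 < AGP_gap 1 t"
  proof (rule strict_increasing_via_deriv[where f = "AGP_gap 1"
        and f' = "\<lambda>x. (1 - sinc x) * (1 + cos x) / (x * (sinc x)\<^sup>2 * (1 + cos x - 1 * sinc x)) * (1 * wilker x - 1)"])
    show "continuous_on {0..t} (AGP_gap 1)"
      using assms by (auto intro: continuous_on_subset[OF continuous_on_AGP_gap])
    fix x assume x: "0 < x" "x < t"
    show "(AGP_gap 1 has_real_derivative
        (1 - sinc x) * (1 + cos x) / (x * (sinc x)\<^sup>2 * (1 + cos x - 1 * sinc x))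
          * (1 * wilker x - 1)) (at x)"
      using x assms by (intro AGP_gap_has_real_derivative) auto
    show "0 < (1 - sinc x) * (1 + cos x) / (x * (sinc x)\<^sup>2 * (1 + cos x - 1 * sinc x))
        * (1 * wilker x - 1)"
      using x assms wilker_gt_1[of x] by (intro mult_pos_pos AGP_gap_weight_pos) auto
  qed (use assms in auto)
  then show ?thesis by (simp add: AGP_gap_def)
qed

lemma AGP_lower_trig:
  assumes "0 < t" "t \<le> pi / 2"
  shows "1 + cos t - sinc t < exp (log_X t)"
proof -
  have "ln (1 + cos t - sinc t) < log_X t"
    using AGP_gap_1_pos[OF assms] by (simp add: AGP_gap_def)
  then show ?thesis
    using AGP_arg_pos[of 1 t] assms by (metis exp_less_cancel_iff exp_ln less_imp_le
        mult_1 order_refl zero_less_one)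
qed

lemma AGP_upper_trig:
  assumes t: "0 < t" "t < pi / 2"
  defines "b \<equiv> pi * (exp 1 - 1) / (2 * exp 1) :: real"
  shows "exp (log_X t) < 1 + cos t - b * sinc t"
proof -
  have e: "exp (1::real) > 1" by simp
  \<comment> \<open>The constant b is chosen so that 1 + cos t - b \<open>sinc t\<close> equals exp
    (-1) at pi/2, that is, so that the gap vanishes there.\<close>
  have b_pi: "b * sinc (pi / 2) = 1 - exp (-1)"
    using e by (simp add: b_def sinc_def exp_minus field_simps)
  (* The lower bound at pi/2 gives b < 1 without numerical estimates of e and pi. *)
  have "1 - sinc (pi / 2) < exp (-1)"
    using AGP_lower_trig[of "pi / 2"] by simp
  then have "b * sinc (pi / 2) < 1 * sinc (pi / 2)"
    unfolding b_pi by simp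
  then have "b < 1"
    using sinc_pos[of "pi / 2"] by simp
  then have b: "0 < b" "b \<le> 1"
    using e by (simp_all add: b_def)
  have "AGP_gap b t < max (AGP_gap b 0) (AGP_gap b (pi / 2))"
  proof (rule less_max_endpoints[where f = "AGP_gap b" and K = "\<lambda>x. b * wilker x - 1"
        and p = "\<lambda>x. (1 - sinc x) * (1 + cos x) / (x * (sinc x)\<^sup>2 * (1 + cos x - b * sinc x))"])
    show "continuous_on {0..pi / 2} (AGP_gap b)"
      by (rule continuous_on_AGP_gap[OF b])
    show "(AGP_gap b has_real_derivative
        (1 - sinc x) * (1 + cos x) / (x * (sinc x)\<^sup>2 * (1 + cos x - b * sinc x))
          * (b * wilker x - 1)) (at x)" if "0 < x" "x < pi / 2" for x
      using that by (rule AGP_gap_has_real_derivative[OF b])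
    show "0 < (1 - sinc x) * (1 + cos x) / (x * (sinc x)\<^sup>2 * (1 + cos x - b * sinc x))"
      if "0 < x" "x < pi / 2" for x
      using that by (rule AGP_gap_weight_pos[OF b])
    show "0 < b * wilker y - 1" if "0 < x" "x < y" "y < pi / 2" "0 \<le> b * wilker x - 1" for x y
      using mult_strict_left_mono[OF wilker_strict_mono[of x y] b(1)] that by simp
  qed (use t in auto)
  \<comment> \<open>At 0 the gap is - ln (2 - b), which is at most 0 since b \<le> 1; at pi/2 it is
    0.\<close>
  also have "\<dots> \<le> 0"
    using b b_pi by (simp add: AGP_gap_def)
  finally have "log_X t < ln (1 + cos t - b * sinc t)"
    by (simp add: AGP_gap_def)
  then show ?thesis
    using AGP_arg_pos[OF b, of t] t by (metis exp_less_cancel_iff exp_ln less_imp_le)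
qed

section \<open>Reduction of the means to one angle\<close>

lemma means_param:
  assumes "a > 0" "b > 0" "a \<noteq> b"
  obtains t where "0 < t" "t < pi / 2"
    "geom_mean a b = arith_mean a b * cos t"
    "seiffert_mean a b = arith_mean a b * sinc t"
    "X_mean a b = arith_mean a b * exp (log_X t)"
proof -
  define x where "x = (a - b) / (a + b)"
  \<comment> \<open>The sign of x depends on the order of a and b. Both \<open>cos\<close> and
    \<open>sinc\<close> are even, so the absolute value changes neither and makes t
    positive.\<close>
  define t where "t = \<bar>arcsin x\<bar>"
  have x: "-1 < x" "x < 1" "x \<noteq> 0"
    using assms by (auto simp: x_def field_simps)
  have "sin (arcsin x) = x"
    using x by simp
  then have "arcsin x \<noteq> 0"
    using x by (metis sin_zero)
  then have t: "0 < t" "t < pi / 2"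
    using x arcsin_lt_bounded[of x] by (auto simp: t_def)
  have A: "arith_mean a b > 0"
    using assms by (simp add: arith_mean_def)
  have "(arith_mean a b)\<^sup>2 * (1 - x\<^sup>2) = a * b"
    using assms by (simp add: arith_mean_def x_def divide_simps)
      (simp add: algebra_simps power2_eq_square)
  moreover have "cos t = sqrt (1 - x\<^sup>2)"
    using x by (simp add: t_def cos_arcsin)
  ultimately have G: "geom_mean a b = arith_mean a b * cos t"
    using A by (metis geom_mean_def real_sqrt_mult real_sqrt_unique less_imp_le)
  have "sinc t = x / arcsin x"
    using x t by (auto simp: sinc_def t_def abs_if)
  moreover have "(a - b) / 2 = arith_mean a b * x"
    using assms by (simp add: arith_mean_def x_def divide_simps)
  moreover have "seiffert_mean a b = (a - b) / 2 / arcsin x"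
    by (simp add: seiffert_mean_def x_def)
  ultimately have P: "seiffert_mean a b = arith_mean a b * sinc t"
    by (simp only: times_divide_eq_right)
  have "X_mean a b = arith_mean a b * exp (log_X t)"
    using A by (simp add: X_mean_def log_X_def G P)
  with that t G P show ?thesis by blast
qed

text \<open>Every angle in the open quadrant is attained by a pair with arithmetic mean 1. Hence the
  trigonometric inequalities are also necessary, as the optimality proofs require.\<close>

lemma means_trig:
  assumes "0 < t" "t < pi / 2"
  shows "1 + sin t > 0" "1 - sin t > 0" "1 + sin t \<noteq> 1 - sin t"
    "arith_mean (1 + sin t) (1 - sin t) = 1"
    "geom_mean (1 + sin t) (1 - sin t) = cos t"
    "seiffert_mean (1 + sin t) (1 - sin t) = sinc t"
    "X_mean (1 + sin t) (1 - sin t) = exp (log_X t)"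
proof -
  have s: "0 < sin t" "sin t < 1" and c: "cos t > 0"
    using assms sin_gt_zero[of t] sin_monotone_2pi[of t "pi / 2"] cos_gt_zero[of t] by auto
  show "1 + sin t > 0" "1 - sin t > 0" "1 + sin t \<noteq> 1 - sin t"
    using s by auto
  show A: "arith_mean (1 + sin t) (1 - sin t) = 1"
    by (simp add: arith_mean_def)
  have "(1 + sin t) * (1 - sin t) = (cos t)\<^sup>2"
    unfolding cos_squared_eq by (simp add: algebra_simps power2_eq_square)
  then show G: "geom_mean (1 + sin t) (1 - sin t) = cos t"
    using c by (simp add: geom_mean_def)
  show P: "seiffert_mean (1 + sin t) (1 - sin t) = sinc t"
    using assms by (simp add: seiffert_mean_def sinc_def arcsin_sin)
  show "X_mean (1 + sin t) (1 - sin t) = exp (log_X t)"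
    by (simp add: X_mean_def log_X_def A G P)
qed

text \<open>One direction evaluates at the pairs of \<open>means_trig\<close>; the other multiplies
  the trigonometric inequality by the positive arithmetic mean. The three equivalences that follow
  are obtained in the same way.\<close>

lemma GA_lower_iff:
  "GA_lower \<alpha> \<longleftrightarrow> (\<forall>t. 0 < t \<longrightarrow> t < pi / 2 \<longrightarrow> \<alpha> * cos t + (1 - \<alpha>) < exp (log_X t))"
  (is "_ \<longleftrightarrow> ?R")
proof
  show "GA_lower \<alpha> \<Longrightarrow> ?R"
    unfolding GA_lower_def by (metis means_trig mult.right_neutral)
  show "GA_lower \<alpha>" if R: ?R
    unfolding GA_lower_def
  proof (intro allI impI)
    fix a b :: real assume ab: "a > 0" "b > 0" "a \<noteq> b"
    then obtain t where t: "0 < t" "t < pi / 2"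
      "geom_mean a b = arith_mean a b * cos t"
      "X_mean a b = arith_mean a b * exp (log_X t)"
      by (rule means_param)
    have "arith_mean a b * (\<alpha> * cos t + (1 - \<alpha>)) < arith_mean a b * exp (log_X t)"
      using R t ab by (intro mult_strict_left_mono) (auto simp: arith_mean_def)
    then show "\<alpha> * geom_mean a b + (1 - \<alpha>) * arith_mean a b < X_mean a b"
      using t by (simp add: algebra_simps)
  qed
qed

lemma GA_upper_iff:
  "GA_upper \<beta> \<longleftrightarrow> (\<forall>t. 0 < t \<longrightarrow> t < pi / 2 \<longrightarrow> exp (log_X t) < \<beta> * cos t + (1 - \<beta>))"
  (is "_ \<longleftrightarrow> ?R")
proof
  show "GA_upper \<beta> \<Longrightarrow> ?R"
    unfolding GA_upper_def by (metis means_trig mult.right_neutral)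
  show "GA_upper \<beta>" if R: ?R
    unfolding GA_upper_def
  proof (intro allI impI)
    fix a b :: real assume ab: "a > 0" "b > 0" "a \<noteq> b"
    then obtain t where t: "0 < t" "t < pi / 2"
      "geom_mean a b = arith_mean a b * cos t"
      "X_mean a b = arith_mean a b * exp (log_X t)"
      by (rule means_param)
    have "arith_mean a b * exp (log_X t) < arith_mean a b * (\<beta> * cos t + (1 - \<beta>))"
      using R t ab by (intro mult_strict_left_mono) (auto simp: arith_mean_def)
    then show "X_mean a b < \<beta> * geom_mean a b + (1 - \<beta>) * arith_mean a b"
      using t by (simp add: algebra_simps)
  qed
qed

lemma AGP_lower_iff:
  "AGP_lower \<alpha> \<longleftrightarrow> (\<forall>t. 0 < t \<longrightarrow> t < pi / 2 \<longrightarrow> 1 + cos t - \<alpha> * sinc t < exp (log_X t))"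
  (is "_ \<longleftrightarrow> ?R")
proof
  show "AGP_lower \<alpha> \<Longrightarrow> ?R"
    unfolding AGP_lower_def by (metis means_trig)
  show "AGP_lower \<alpha>" if R: ?R
    unfolding AGP_lower_def
  proof (intro allI impI)
    fix a b :: real assume ab: "a > 0" "b > 0" "a \<noteq> b"
    then obtain t where t: "0 < t" "t < pi / 2"
      "geom_mean a b = arith_mean a b * cos t"
      "seiffert_mean a b = arith_mean a b * sinc t"
      "X_mean a b = arith_mean a b * exp (log_X t)"
      by (rule means_param)
    have "arith_mean a b * (1 + cos t - \<alpha> * sinc t) < arith_mean a b * exp (log_X t)"
      using R t ab by (intro mult_strict_left_mono) (auto simp: arith_mean_def)
    then show "arith_mean a b + geom_mean a b - \<alpha> * seiffert_mean a b < X_mean a b"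
      using t by (simp add: algebra_simps)
  qed
qed

lemma AGP_upper_iff:
  "AGP_upper \<beta> \<longleftrightarrow> (\<forall>t. 0 < t \<longrightarrow> t < pi / 2 \<longrightarrow> exp (log_X t) < 1 + cos t - \<beta> * sinc t)"
  (is "_ \<longleftrightarrow> ?R")
proof
  show "AGP_upper \<beta> \<Longrightarrow> ?R"
    unfolding AGP_upper_def by (metis means_trig)
  show "AGP_upper \<beta>" if R: ?R
    unfolding AGP_upper_def
  proof (intro allI impI)
    fix a b :: real assume ab: "a > 0" "b > 0" "a \<noteq> b"
    then obtain t where t: "0 < t" "t < pi / 2"
      "geom_mean a b = arith_mean a b * cos t"
      "seiffert_mean a b = arith_mean a b * sinc t"
      "X_mean a b = arith_mean a b * exp (log_X t)"
      by (rule means_param)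
    have "arith_mean a b * exp (log_X t) < arith_mean a b * (1 + cos t - \<beta> * sinc t)"
      using R t ab by (intro mult_strict_left_mono) (auto simp: arith_mean_def)
    then show "X_mean a b < arith_mean a b + geom_mean a b - \<beta> * seiffert_mean a b"
      using t by (simp add: algebra_simps)
  qed
qed

section \<open>Optimality of the constants\<close>

lemma eventually_at_right_0_quadrant: "\<forall>\<^sub>F t in at_right (0::real). 0 < t \<and> t < pi / 2"
  unfolding eventually_at_right_field by (rule exI[of _ "pi / 2"]) auto

lemma eventually_at_left_pi_half_quadrant: "\<forall>\<^sub>F t in at_left (pi / 2). 0 < t \<and> t < pi / 2"
  unfolding eventually_at_left_field by (rule exI[of _ 0]) auto

lemma GA_lower_imp_ge:
  assumes "GA_lower \<alpha>"
  shows "2 / 3 \<le> \<alpha>"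
proof (rule tendsto_upperbound)
  \<comment> \<open>The inequality solved for \<alpha>. Writing \<open>sin t / t\<close> for
    \<open>sinc t\<close>, which agrees with it for t > 0, gives \<open>real_asymp\<close> an
    explicit expression to expand.\<close>
  show "((\<lambda>t::real. (1 - exp (cos t / (sin t / t) - 1)) / (1 - cos t)) \<longlongrightarrow> 2 / 3) (at_right 0)"
    by real_asymp
  show "\<forall>\<^sub>F t in at_right 0. (1 - exp (cos t / (sin t / t) - 1)) / (1 - cos t) \<le> \<alpha>"
    using eventually_at_right_0_quadrant
  proof eventually_elim
    case (elim t)
    then have "cos t < 1" "\<alpha> * cos t + (1 - \<alpha>) < exp (log_X t)"
      using assms cos_monotone_0_pi[of 0 t] by (auto simp: GA_lower_iff)
    with elim show ?case
      by (simp add: log_X_def sinc_def field_simps)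
  qed
qed simp

text \<open>The inequality solved for \<beta> bounds it by (1 - X) / (1 - cos t). This quotient is
  continuous up to pi/2, where its value is 1 - exp (-1).\<close>

lemma GA_upper_imp_le:
  assumes "GA_upper \<beta>"
  shows "\<beta> \<le> (exp 1 - 1) / exp 1"
proof -
  have "\<beta> \<le> 1 - exp (-1)"
  proof (rule tendsto_lowerbound)
    have "((\<lambda>t. (1 - exp (log_X t)) / (1 - cos t)) \<longlongrightarrow>
        (1 - exp (log_X (pi / 2))) / (1 - cos (pi / 2))) (at_left (pi / 2))"
      by (intro tendsto_intros continuous_on_Icc_at_leftD[OF continuous_on_log_X]) auto
    then show "((\<lambda>t. (1 - exp (log_X t)) / (1 - cos t)) \<longlongrightarrow> 1 - exp (-1)) (at_left (pi / 2))"
      by simp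
    show "\<forall>\<^sub>F t in at_left (pi / 2). \<beta> \<le> (1 - exp (log_X t)) / (1 - cos t)"
      using eventually_at_left_pi_half_quadrant
    proof eventually_elim
      case (elim t)
      then have "cos t < 1" "exp (log_X t) < \<beta> * cos t + (1 - \<beta>)"
        using assms cos_monotone_0_pi[of 0 t] by (auto simp: GA_upper_iff)
      then show ?case by (simp add: field_simps)
    qed
  qed simp
  then show ?thesis by (simp add: exp_minus field_simps)
qed

lemma AGP_lower_imp_ge:
  assumes "AGP_lower \<alpha>"
  shows "1 \<le> \<alpha>"
proof (rule tendsto_upperbound)
  show "((\<lambda>t::real. (1 + cos t - exp (cos t / (sin t / t) - 1)) / (sin t / t)) \<longlongrightarrow> 1) (at_right 0)"
    by real_asymp
  show "\<forall>\<^sub>F t in at_right 0. (1 + cos t - exp (cos t / (sin t / t) - 1)) / (sin t / t) \<le> \<alpha>"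
    using eventually_at_right_0_quadrant
  proof eventually_elim
    case (elim t)
    then have "sinc t > 0" "1 + cos t - \<alpha> * sinc t < exp (log_X t)"
      using assms by (auto simp: AGP_lower_iff sinc_pos)
    then have "(1 + cos t - exp (log_X t)) / sinc t \<le> \<alpha>"
      by (simp add: field_simps)
    with elim show ?case
      by (simp add: log_X_def sinc_def)
  qed
qed simp

text \<open>Solving for \<beta> gives the bound (1 + cos t - X) / \<open>sinc t\<close>, whose limit
  at pi/2 is 1 - exp (-1) divided by 2 / pi.\<close>

lemma AGP_upper_imp_le:
  assumes "AGP_upper \<beta>"
  shows "\<beta> \<le> pi * (exp 1 - 1) / (2 * exp 1)"
proof -
  have "\<beta> \<le> (1 - exp (-1)) / sinc (pi / 2)"
  proof (rule tendsto_lowerbound)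
    have "sinc (pi / 2) > 0"
      by (simp add: sinc_pos)
    then have "((\<lambda>t. (1 + cos t - exp (log_X t)) / sinc t) \<longlongrightarrow>
        (1 + cos (pi / 2) - exp (log_X (pi / 2))) / sinc (pi / 2)) (at_left (pi / 2))"
      by (intro tendsto_intros continuous_on_Icc_at_leftD[OF continuous_on_log_X]
          continuous_on_Icc_at_leftD[of 0, OF continuous_on_sinc[OF continuous_on_id]]) auto
    then show "((\<lambda>t. (1 + cos t - exp (log_X t)) / sinc t) \<longlongrightarrow>
        (1 - exp (-1)) / sinc (pi / 2)) (at_left (pi / 2))"
      by simp
    show "\<forall>\<^sub>F t in at_left (pi / 2). \<beta> \<le> (1 + cos t - exp (log_X t)) / sinc t"
      using eventually_at_left_pi_half_quadrant
    proof eventually_elim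
      case (elim t)
      then have "sinc t > 0" "exp (log_X t) < 1 + cos t - \<beta> * sinc t"
        using assms by (auto simp: AGP_upper_iff sinc_pos)
      then show ?case by (simp add: field_simps)
    qed
  qed simp
  then show ?thesis by (simp add: sinc_def exp_minus field_simps)
qed

theorem theorem2p1:
  shows "(GA_lower (2 / 3) \<and> (\<forall>\<alpha>::real. \<alpha> < 2 / 3 \<longrightarrow> \<not> GA_lower \<alpha>)) \<and>
    (GA_upper ((exp 1 - 1) / exp 1) \<and>
       (\<forall>\<beta>::real. \<beta> > (exp 1 - 1) / exp 1 \<longrightarrow> \<not> GA_upper \<beta>)) \<and>
    (AGP_lower 1 \<and> (\<forall>\<alpha>\<^sub>1::real. \<alpha>\<^sub>1 < 1 \<longrightarrow> \<not> AGP_lower \<alpha>\<^sub>1)) \<and>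
    (AGP_upper (pi * (exp 1 - 1) / (2 * exp 1)) \<and>
       (\<forall>\<beta>\<^sub>1::real. \<beta>\<^sub>1 > pi * (exp 1 - 1) / (2 * exp 1) \<longrightarrow> \<not> AGP_upper \<beta>\<^sub>1))"
proof -
  have "GA_lower (2 / 3)"
    using GA_lower_trig by (simp add: GA_lower_iff)
  moreover have "GA_upper ((exp 1 - 1) / exp 1)"
    unfolding GA_upper_iff using GA_upper_trig by blast
  moreover have "AGP_lower 1"
    using AGP_lower_trig by (simp add: AGP_lower_iff)
  moreover have "AGP_upper (pi * (exp 1 - 1) / (2 * exp 1))"
    unfolding AGP_upper_iff using AGP_upper_trig by blast
  ultimately show ?thesis
    using GA_lower_imp_ge GA_upper_imp_le AGP_lower_imp_ge AGP_upper_imp_le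
    by (meson not_less)
qed

end
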